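(* Let $\mathbb{F}_q$ be any finite field, and let $M$ be any non-free, $\mathbb{F}_q$-representable matroid. If $m:\mathbb{N}\to\mathbb{N}$ satisfies $m(n)-n\to\infty$ as $n \to \infty$, then $$\lim_{n\to\infty}\mathbb{P}_{A_n\sim[U_q]^{m(n)\times n}}\{M \text{ is a minor of } M[A_n]\}=0.$$
   Context: $\mathbb{F}_q$ is the finite field with $q$ elements. $[U_q]^{m\times n}$ denotes the uniform distribution on $\mathbb{F}_q^{m\times n}$ (entries i.i.d. uniform on $\mathbb{F}_q$), and $A \sim [U_q]^{m \times n}$ means that $A$ is drawn from it. For a matrix $A$ over $\mathbb{F}_q$ with $n$ columns, $M[A]$ is the column dependence matroid of $A$: its ground set is the set of column indices $\{1,\dots,n\}$, and a set of indices is independent iff the corresponding columns form a linearly independent family. All matroids are finite. A matroid is $\mathbb{F}_q$-representable if it is isomorphic to $M[A]$ for some matrix $A$ over $\mathbb{F}_q$. A matroid is free if every subset of its ground set is independent, and non-free otherwise. "$M$ is a minor of $N$" means that $M$ is isomorphic to a matroid obtained from $N$ by a sequence of deletions and contractions. *)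

theory Defs
  imports "HOL-Probability.Probability" "Jordan_Normal_Form.VS_Connect"
begin

unbundle no vec_syntax

section \<open>Matroids, given by their independent sets\<close>

datatype 'e set_system = Set_System (ground: "'e set") (indeps: "'e set set")

definition matroid :: "'e set_system \<Rightarrow> bool" where
  "matroid M \<longleftrightarrow>
     finite (ground M) \<and>
     indeps M \<subseteq> Pow (ground M) \<and>
     {} \<in> indeps M \<and>
     (\<forall>X Y. Y \<in> indeps M \<longrightarrow> X \<subseteq> Y \<longrightarrow> X \<in> indeps M) \<and>
     (\<forall>X Y. X \<in> indeps M \<longrightarrow> Y \<in> indeps M \<longrightarrow> card X < card Y \<longrightarrow>
        (\<exists>y \<in> Y - X. insert y X \<in> indeps M))"

definition free :: "'e set_system \<Rightarrow> bool" where
  "free M \<longleftrightarrow> (\<forall>X. X \<subseteq> ground M \<longrightarrow> X \<in> indeps M)"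

definition isomorphic :: "'e set_system \<Rightarrow> 'f set_system \<Rightarrow> bool" where
  "isomorphic M N \<longleftrightarrow>
     (\<exists>f. bij_betw f (ground M) (ground N) \<and>
          (\<forall>X. X \<subseteq> ground M \<longrightarrow> (X \<in> indeps M \<longleftrightarrow> f ` X \<in> indeps N)))"

subsection \<open>Minors\<close>

definition deletion :: "'e set_system \<Rightarrow> 'e set \<Rightarrow> 'e set_system" where
  "deletion M T = Set_System (ground M - T) {X. X \<subseteq> ground M - T \<and> X \<in> indeps M}"

definition basis_of :: "'e set_system \<Rightarrow> 'e set \<Rightarrow> 'e set \<Rightarrow> bool" where
  "basis_of M T B \<longleftrightarrow>
     B \<subseteq> T \<and> B \<in> indeps M \<and> (\<forall>C. B \<subseteq> C \<longrightarrow> C \<subseteq> T \<longrightarrow> C \<in> indeps M \<longrightarrow> C = B)"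

text \<open>In a matroid the independence of \<open>X \<union> B\<close> below does not depend on the choice of the
  basis \<open>B\<close> of \<open>T\<close>, so the existential quantifier could equally be a universal one.\<close>

definition contraction :: "'e set_system \<Rightarrow> 'e set \<Rightarrow> 'e set_system" where
  "contraction M T = Set_System (ground M - T)
     {X. X \<subseteq> ground M - T \<and> (\<exists>B. basis_of M T B \<and> X \<union> B \<in> indeps M)}"

inductive del_contr_seq :: "'e set_system \<Rightarrow> 'e set_system \<Rightarrow> bool" for N where
  refl: "del_contr_seq N N"
| delete: "del_contr_seq N M \<Longrightarrow> T \<subseteq> ground M \<Longrightarrow> del_contr_seq N (deletion M T)"
| contract: "del_contr_seq N M \<Longrightarrow> T \<subseteq> ground M \<Longrightarrow> del_contr_seq N (contraction M T)"

definition is_minor :: "'e set_system \<Rightarrow> 'f set_system \<Rightarrow> bool" where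
  "is_minor M N \<longleftrightarrow> (\<exists>N'. del_contr_seq N N' \<and> isomorphic M N')"


section \<open>Column dependence matroids\<close>

text \<open>The library's linear dependence is a property of sets of vectors; a family of columns is
  linearly independent iff it has no repetitions and its range is a linearly independent set.\<close>

definition indep_cols :: "'a :: field mat \<Rightarrow> nat set \<Rightarrow> bool" where
  "indep_cols A S \<longleftrightarrow>
     inj_on (col A) S \<and>
     \<not> module.lin_dep class_ring (module_vec TYPE('a) (dim_row A)) (col A ` S)"

definition column_matroid :: "'a :: field mat \<Rightarrow> nat set_system" where
  "column_matroid A =
     Set_System {..<dim_col A} {S. S \<subseteq> {..<dim_col A} \<and> indep_cols A S}"

definition representable :: "'a :: field itself \<Rightarrow> 'e set_system \<Rightarrow> bool" where
  "representable _ M \<longleftrightarrow> (\<exists>A :: 'a mat. isomorphic M (column_matroid A))"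

lemma indep_cols_iff:
  fixes A :: "'a :: field mat"
  assumes "S \<subseteq> {..<dim_col A}"
  shows "indep_cols A S \<longleftrightarrow>
    (\<forall>c. (\<forall>i<dim_row A. (\<Sum>j\<in>S. c j * A $$ (i, j)) = 0) \<longrightarrow> (\<forall>j\<in>S. c j = 0))"
proof -
  interpret vec_space "TYPE('a)" "dim_row A" .
  have fin: "finite S" using assms finite_subset by blast
  have carr: "col A ` S \<subseteq> carrier_vec (dim_row A)" by auto
  have entry: "col A j $ i = A $$ (i, j)" if "i < dim_row A" "j \<in> S" for i j
    using that assms by auto
  have lc: "lincomb a (col A ` S) $ i = (\<Sum>j\<in>S. a (col A j) * A $$ (i, j))"
    if "inj_on (col A) S" "i < dim_row A" for a i
  proof -
    have "lincomb a (col A ` S) $ i = (\<Sum>x\<in>col A ` S. a x * x $ i)"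
      using that(2) carr by (rule lincomb_index)
    also have "\<dots> = (\<Sum>j\<in>S. a (col A j) * col A j $ i)"
      using that(1) by (simp add: sum.reindex)
    also have "\<dots> = (\<Sum>j\<in>S. a (col A j) * A $$ (i, j))"
      using entry[OF that(2)] by simp
    finally show ?thesis .
  qed
  have lc0: "lincomb a (col A ` S) = 0\<^sub>v (dim_row A) \<longleftrightarrow>
      (\<forall>i<dim_row A. (\<Sum>j\<in>S. a (col A j) * A $$ (i, j)) = 0)"
    if "inj_on (col A) S" for a
  proof -
    have "dim_vec (lincomb a (col A ` S)) = dim_row A"
      using carr fin by (intro lincomb_dim) auto
    then show ?thesis using lc[OF that] by (auto simp: vec_eq_iff)
  qed
  show ?thesis (is "_ \<longleftrightarrow> ?R")
  proof
    assume ind: "indep_cols A S"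
    then have inj: "inj_on (col A) S" and li: "\<not> lin_dep (col A ` S)"
      by (auto simp: indep_cols_def)
    show ?R
    proof (intro allI impI ballI)
      fix c j assume c: "\<forall>i<dim_row A. (\<Sum>j\<in>S. c j * A $$ (i, j)) = 0" and j: "j \<in> S"
      define a where "a = (\<lambda>v. c (the_inv_into S (col A) v))"
      have a: "a (col A j) = c j" if "j \<in> S" for j
        using that inj by (simp add: a_def the_inv_into_f_f)
      have "lincomb a (col A ` S) = 0\<^sub>v (dim_row A)"
        using c a by (simp add: lc0[OF inj])
      then have "a (col A j) = 0"
        using li fin j unfolding lin_dep_def by fastforce
      then show "c j = 0" using a j by simp
    qed
  next
    assume R: ?R
    have inj: "inj_on (col A) S"
    proof (rule inj_onI, rule ccontr)
      fix x y assume xy: "x \<in> S" "y \<in> S" "col A x = col A y" "x \<noteq> y"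
      define c :: "nat \<Rightarrow> 'a" where "c j = (if j = x then 1 else if j = y then - 1 else 0)" for j
      have "(\<Sum>j\<in>S. c j * A $$ (i, j)) = 0" if i: "i < dim_row A" for i
      proof -
        have "(\<Sum>j\<in>S. c j * A $$ (i, j)) = (\<Sum>j\<in>{x, y}. c j * A $$ (i, j))"
          using xy fin by (intro sum.mono_neutral_right) (auto simp: c_def)
        also have "\<dots> = A $$ (i, x) - A $$ (i, y)" using xy by (simp add: c_def)
        also have "\<dots> = 0" using entry[OF i] xy by (metis right_minus_eq)
        finally show ?thesis .
      qed
      then have "c x = 0" using R xy by blast
      then show False by (simp add: c_def)
    qed
    moreover have "\<not> lin_dep (col A ` S)"
    proof
      assume "lin_dep (col A ` S)"
      then obtain a v where a: "lincomb a (col A ` S) = 0\<^sub>v (dim_row A)"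
          and v: "v \<in> col A ` S" "a v \<noteq> 0"
        using finite_lin_dep[of "col A ` S"] fin carr by auto
      have "\<forall>i<dim_row A. (\<Sum>j\<in>S. a (col A j) * A $$ (i, j)) = 0"
        using a unfolding lc0[OF inj] .
      then have "\<forall>j\<in>S. a (col A j) = 0"
        by (rule R[THEN spec, THEN mp])
      then show False using v by auto
    qed
    ultimately show "indep_cols A S" by (simp add: indep_cols_def)
  qed
qed

lemma matroid_column_matroid:
  fixes A :: "'a :: field mat"
  shows "matroid (column_matroid A)"
proof -
  interpret vec_space "TYPE('a)" "dim_row A" .
  have aug: "\<exists>y \<in> Y - X. indep_cols A (insert y X)"
    if X: "indep_cols A X" and Y: "indep_cols A Y" and fin: "finite X" "finite Y"
      and less: "card X < card Y" for X Y
  proof (rule ccontr)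
    assume no: "\<not> ?thesis"
    have X': "inj_on (col A) X" "\<not> lin_dep (col A ` X)"
      and Y': "inj_on (col A) Y" "\<not> lin_dep (col A ` Y)"
      using X Y by (auto simp: indep_cols_def)
    have carr: "col A ` Z \<subseteq> carrier_vec (dim_row A)" for Z by auto
    have "col A y \<in> span (col A ` X)" if y: "y \<in> Y" for y
    proof (cases "col A y \<in> col A ` X")
      case True
      then show ?thesis using in_own_span[OF carr] by blast
    next
      case False
      then have "inj_on (col A) (insert y X)" "y \<in> Y - X" using X' y by auto
      then have "lin_dep (col A ` insert y X)" using no by (auto simp: indep_cols_def)
      then show ?thesis
        using lin_dep_iff_in_span[OF carr X'(2) _ False] by simp
    qed
    then have "col A ` Y \<subseteq> span (col A ` X)" by auto
    from replacement[OF _ _ carr Y'(2) this] fin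
    have "card (col A ` Y) \<le> card (col A ` X)" by fastforce
    then show False using less X' Y' by (simp add: card_image)
  qed
  have sub: "indep_cols A X" if "indep_cols A Y" "X \<subseteq> Y" for X Y
    using that subset_li_is_li[of "col A ` Y" "col A ` X"]
    by (auto simp: indep_cols_def intro: inj_on_subset)
  have emp: "indep_cols A {}"
    by (simp add: indep_cols_iff)
  have "\<exists>y \<in> Y - X. insert y X \<in> indeps (column_matroid A)"
    if "X \<in> indeps (column_matroid A)" "Y \<in> indeps (column_matroid A)"
      and less: "card X < card Y" for X Y
  proof -
    have XY: "X \<subseteq> {..<dim_col A}" "Y \<subseteq> {..<dim_col A}" "indep_cols A X" "indep_cols A Y"
      using that by (auto simp: column_matroid_def)
    then obtain y where "y \<in> Y - X" "indep_cols A (insert y X)"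
      using aug[of X Y] less finite_subset[OF _ finite_lessThan] by blast
    then show ?thesis using XY by (intro bexI[of _ y]) (auto simp: column_matroid_def)
  qed
  moreover have "X \<in> indeps (column_matroid A)"
    if "Y \<in> indeps (column_matroid A)" "X \<subseteq> Y" for X Y
    using that sub by (auto simp: column_matroid_def)
  moreover have "{} \<in> indeps (column_matroid A)" "finite (ground (column_matroid A))"
    "indeps (column_matroid A) \<subseteq> Pow (ground (column_matroid A))"
    using emp by (auto simp: column_matroid_def)
  ultimately show ?thesis unfolding matroid_def by blast
qed


section \<open>Uniformly random matrices\<close>

lemma carrier_mat_nonempty: "carrier_mat m n \<noteq> {}"
  using mat_carrier by blast

lemma finite_carrier_mat: "finite (carrier_mat m n :: 'a :: finite mat set)"
proof -
  have "carrier_mat m n \<subseteq>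
      (\<lambda>f. mat m n f) ` (({..<m} \<times> {..<n}) \<rightarrow>\<^sub>E (UNIV :: 'a set))"
  proof
    fix A :: "'a mat" assume A: "A \<in> carrier_mat m n"
    then have "A = mat m n (restrict (\<lambda>ij. A $$ ij) ({..<m} \<times> {..<n}))"
      by (intro eq_matI) auto
    then show "A \<in> (\<lambda>f. mat m n f) ` (({..<m} \<times> {..<n}) \<rightarrow>\<^sub>E UNIV)"
      by (metis (no_types, lifting) image_eqI restrict_PiE_iff UNIV_I)
  qed
  then show ?thesis
    by (rule finite_subset) (intro finite_imageI finite_PiE, auto)
qed

definition uniform_mat :: "nat \<Rightarrow> nat \<Rightarrow> 'a :: finite mat pmf" where
  "uniform_mat m n = pmf_of_set (carrier_mat m n)"

end

theory Submission
  imports Defs "Berlekamp_Zassenhaus.Berlekamp_Type_Based"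
begin

text \<open>Minors of a free matroid are free, so a random matrix \<open>A\<close> whose column matroid has a non-free
  minor kills some nonzero vector \<open>c\<close>. A fixed \<open>c\<close> is killed with probability \<open>q\<^sup>-\<^sup>m\<close>, so a
  union bound over the at most \<open>q\<^sup>n\<close> choices of \<open>c\<close> gives probability at most \<open>q\<^sup>n\<^sup>-\<^sup>m\<close>.\<close>

lemma free_deletion: "free N \<Longrightarrow> free (deletion N T)"
  by (auto simp: free_def deletion_def)

text \<open>In a free matroid \<open>T\<close> is a basis of itself, so independence after
  contraction can be tested by \<open>X \<union> T\<close>, which is independent like every other
  subset of the ground set.\<close>

lemma free_contraction:
  assumes "free N" "T \<subseteq> ground N"
  shows "free (contraction N T)"
proof -
  have "basis_of N T T"
    using assms by (auto simp: basis_of_def free_def)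
  moreover have "X \<union> T \<in> indeps N" if "X \<subseteq> ground N - T" for X
    using assms that unfolding free_def by (meson Diff_subset Un_least subset_trans)
  ultimately show ?thesis
    by (auto simp: free_def contraction_def)
qed

lemma free_del_contr_seq: "del_contr_seq N N' \<Longrightarrow> free N \<Longrightarrow> free N'"
  by (induction rule: del_contr_seq.induct) (auto intro: free_deletion free_contraction)

lemma free_isomorphic:
  assumes "isomorphic M N" "free N"
  shows "free M"
proof -
  obtain f where f: "f ` ground M = ground N"
      "\<And>X. X \<subseteq> ground M \<Longrightarrow> X \<in> indeps M \<longleftrightarrow> f ` X \<in> indeps N"
    using assms(1) unfolding isomorphic_def bij_betw_def by blast
  show ?thesis
    using assms(2) f unfolding free_def by (metis image_mono)
qed

lemma free_minor: "is_minor M N \<Longrightarrow> free N \<Longrightarrow> free M"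
  unfolding is_minor_def using free_del_contr_seq free_isomorphic by metis

lemma not_free_column_matroid_imp_kernel:
  fixes A :: "'a :: field mat"
  assumes "\<not> free (column_matroid A)"
  shows "\<exists>c \<in> carrier_vec (dim_col A). c \<noteq> 0\<^sub>v (dim_col A) \<and> A *\<^sub>v c = 0\<^sub>v (dim_row A)"
proof -
  obtain S where S: "S \<subseteq> {..<dim_col A}" "\<not> indep_cols A S"
    using assms by (auto simp: free_def column_matroid_def)
  then obtain c j where c: "\<And>i. i < dim_row A \<Longrightarrow> (\<Sum>j\<in>S. c j * A $$ (i, j)) = 0"
      and j: "j \<in> S" "c j \<noteq> 0"
    by (auto simp: indep_cols_iff)
  \<comment> \<open>The coefficients of a linear relation among the columns in \<open>S\<close>,
    extended by zero to all columns, form a kernel vector.\<close>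
  define v where "v = vec (dim_col A) (\<lambda>k. if k \<in> S then c k else 0)"
  have "(A *\<^sub>v v) $ i = 0" if i: "i < dim_row A" for i
  proof -
    have "(A *\<^sub>v v) $ i = (\<Sum>k\<in>{..<dim_col A}. A $$ (i, k) * (if k \<in> S then c k else 0))"
      using i by (simp add: scalar_prod_def v_def atLeast0LessThan)
    also have "\<dots> = (\<Sum>k\<in>S. c k * A $$ (i, k))"
      using S(1) by (intro sum.mono_neutral_cong_right) (auto simp: mult.commute)
    finally show ?thesis using c i by simp
  qed
  then have "A *\<^sub>v v = 0\<^sub>v (dim_row A)" by (intro eq_vecI) auto
  moreover have "v $ j \<noteq> 0" "j < dim_col A" using j S(1) by (auto simp: v_def)
  then have "v \<noteq> 0\<^sub>v (dim_col A)" by auto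
  moreover have "v \<in> carrier_vec (dim_col A)" by (simp add: v_def)
  ultimately show ?thesis by blast
qed

text \<open>Adding an arbitrary vector to a column \<open>j\<close> with \<open>c\<^sub>j \<noteq> 0\<close> changes \<open>A c\<close> to an arbitrary
  value, so distinct such modifications of matrices killing \<open>c\<close> are distinct.\<close>

lemma card_killing_matrices_le:
  fixes c :: "'a :: {field, finite} vec"
  assumes c: "c \<in> carrier_vec n" "c \<noteq> 0\<^sub>v n"
  shows "card {A \<in> carrier_mat m n. A *\<^sub>v c = 0\<^sub>v m} * CARD('a) ^ m
           \<le> card (carrier_mat m n :: 'a mat set)"
proof -
  obtain j where j: "j < n" "c $ j \<noteq> 0"
    using c by (metis carrier_vecD eq_vecI index_zero_vec)
  define K where "K = {A \<in> carrier_mat m n. A *\<^sub>v c = 0\<^sub>v m}"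
  \<comment> \<open>The perturbation is confined to column \<open>j\<close>, so its effect on
    \<open>c\<close> is just \<open>v\<close> scaled by the invertible entry
    \<open>c $ j\<close>.\<close>
  define E where "E v = mat m n (\<lambda>(i, k). if k = j then v $ i else 0)" for v :: "'a vec"
  have E: "E v \<in> carrier_mat m n" for v by (simp add: E_def)
  have Ec: "E v *\<^sub>v c = c $ j \<cdot>\<^sub>v v" if "v \<in> carrier_vec m" for v
  proof (rule eq_vecI)
    fix i assume "i < dim_vec (c $ j \<cdot>\<^sub>v v)"
    then have i: "i < m" using that by simp
    have "(E v *\<^sub>v c) $ i = (\<Sum>k\<in>{..<n}. (if k = j then v $ i else 0) * c $ k)"
      using i c by (simp add: E_def scalar_prod_def atLeast0LessThan)
    also have "\<dots> = (\<Sum>k\<in>{..<n}. if k = j then v $ i * c $ k else 0)"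
      by (intro sum.cong) auto
    also have "\<dots> = v $ i * c $ j" using j by simp
    finally show "(E v *\<^sub>v c) $ i = (c $ j \<cdot>\<^sub>v v) $ i" using i that by (simp add: mult.commute)
  qed (use that in \<open>simp add: E_def\<close>)
  have sum_c: "(A + E v) *\<^sub>v c = c $ j \<cdot>\<^sub>v v" if "A \<in> K" "v \<in> carrier_vec m" for A v
    using that c E[of v] by (simp add: K_def add_mult_distrib_mat_vec[of _ m n] Ec)
  have "inj_on (\<lambda>(A, v). A + E v) (K \<times> carrier_vec m)"
  proof (rule inj_onI, clarify)
    fix A v B w
    assume A: "A \<in> K" "B \<in> K" and v: "v \<in> carrier_vec m" "w \<in> carrier_vec m"
      and eq: "A + E v = B + E w"
    \<comment> \<open>Applying both sides of \<open>eq\<close> to \<open>c\<close> eliminates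
      \<open>A\<close> and \<open>B\<close>, which kill \<open>c\<close>. Once \<open>v = w\<close>
      is known, the perturbation cancels and \<open>A = B\<close> follows.\<close>
    have "c $ j \<cdot>\<^sub>v v = c $ j \<cdot>\<^sub>v w"
      using sum_c A v eq by metis
    then have "c $ j * v $ i = c $ j * w $ i" if "i < m" for i
      using that v by (metis carrier_vecD index_smult_vec(1))
    then have vw: "v = w" using v j by (intro eq_vecI) auto
    have "A $$ (i, k) = B $$ (i, k)" if "i < m" "k < n" for i k
    proof -
      have "(A + E v) $$ (i, k) = (B + E v) $$ (i, k)" using eq vw by simp
      then show ?thesis using that E[of v] by simp
    qed
    then have "A = B" using A by (intro eq_matI) (auto simp: K_def)
    with vw show "A = B \<and> v = w" by simp
  qed
  moreover have "(\<lambda>(A, v). A + E v) ` (K \<times> carrier_vec m) \<subseteq> carrier_mat m n"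
    using E by (auto simp: K_def)
  ultimately have "card (K \<times> (carrier_vec m :: 'a vec set)) \<le> card (carrier_mat m n :: 'a mat set)"
    using finite_carrier_mat card_inj_on_le by blast
  then show ?thesis
    by (simp add: card_cartesian_product card_carrier_vec K_def)
qed

lemma prob_not_free_le:
  "measure_pmf.prob (uniform_mat m n :: 'a :: {field, finite} mat pmf)
     {A. \<not> free (column_matroid A)} \<le> real CARD('a) ^ n / real CARD('a) ^ m"
proof -
  let ?q = "real CARD('a)" and ?C = "carrier_mat m n :: 'a mat set"
  define K where "K c = {A \<in> ?C. A *\<^sub>v c = 0\<^sub>v m}" for c
  \<comment> \<open>The zero vector must be left out: every matrix kills it, so \<open>K c\<close>
    is small only for nonzero \<open>c\<close>.\<close>
  define V where "V = carrier_vec n - {0\<^sub>v n :: 'a vec}"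
  have fin: "finite V" "finite (K c)" for c
    by (auto simp: V_def K_def finite_carrier_vec finite_carrier_mat)
  have C: "card ?C > 0"
    by (simp add: card_gt_0_iff finite_carrier_mat carrier_mat_nonempty)
  have q: "?q > 0" by (simp add: card_gt_0_iff)
  have "?C \<inter> {A. \<not> free (column_matroid A)} \<subseteq> (\<Union>c\<in>V. K c)"
    using not_free_column_matroid_imp_kernel by (fastforce simp: V_def K_def)
  then have "card (?C \<inter> {A. \<not> free (column_matroid A)}) \<le> card (\<Union>c\<in>V. K c)"
    using fin by (intro card_mono) auto
  also have "\<dots> \<le> (\<Sum>c\<in>V. card (K c))"
    using fin by (intro card_UN_le)
  finally have "real (card (?C \<inter> {A. \<not> free (column_matroid A)})) \<le> (\<Sum>c\<in>V. real (card (K c)))"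
    by (metis of_nat_le_iff of_nat_sum)
  also have "\<dots> \<le> (\<Sum>c\<in>V. real (card ?C) / ?q ^ m)"
  proof (rule sum_mono)
    fix c assume "c \<in> V"
    then have "card (K c) * CARD('a) ^ m \<le> card ?C"
      unfolding V_def K_def by (intro card_killing_matrices_le) auto
    then have "real (card (K c)) * ?q ^ m \<le> real (card ?C)"
      by (metis of_nat_le_iff of_nat_mult of_nat_power)
    then show "real (card (K c)) \<le> real (card ?C) / ?q ^ m"
      using q by (simp add: pos_le_divide_eq)
  qed
  also have "\<dots> = real (card V) * (real (card ?C) / ?q ^ m)" by simp
  also have "\<dots> \<le> ?q ^ n * (real (card ?C) / ?q ^ m)"
  proof (rule mult_right_mono)
    have "card V \<le> CARD('a) ^ n"
      unfolding V_def by (metis card_Diff1_le card_carrier_vec)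
    then show "real (card V) \<le> ?q ^ n"
      by (metis of_nat_le_iff of_nat_power)
  qed simp
  \<comment> \<open>Under the uniform distribution the probability is this count divided by
    \<open>card ?C\<close>, which cancels against the same factor in the bound.\<close>
  finally show ?thesis
    using C by (simp add: uniform_mat_def measure_pmf_of_set finite_carrier_mat
        carrier_mat_nonempty divide_le_eq mult.commute)
qed

theorem theorem3:
  fixes M :: "'e set_system" and m :: "nat \<Rightarrow> nat"
  assumes "matroid M"
    and "\<not> free M"
    and "representable TYPE('a :: {field, finite}) M"
    and "filterlim (\<lambda>n. int (m n) - int n) at_top sequentially"
  shows "(\<lambda>n. measure_pmf.prob (uniform_mat (m n) n :: 'a mat pmf)
            {A. is_minor M (column_matroid A)}) \<longlonglongrightarrow> 0"
proof (rule tendsto_sandwich[OF _ _ tendsto_const])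
  let ?q = "real CARD('a)"
  \<comment> \<open>A field has \<open>0 \<noteq> 1\<close>, so \<open>1 / ?q\<close> is below 1 and
    its powers tend to 0.\<close>
  have "card {0, 1 :: 'a} \<le> CARD('a)" by (intro card_mono) auto
  then have q: "?q > 1" by simp
  have "filterlim (\<lambda>n. nat (int (m n) - int n)) sequentially sequentially"
    using assms(4) filterlim_nat_sequentially by (rule filterlim_compose[rotated])
  moreover have "(\<lambda>k. (1 / ?q) ^ k) \<longlonglongrightarrow> 0"
    using q by (intro LIMSEQ_realpow_zero) auto
  ultimately show "(\<lambda>n. (1 / ?q) ^ nat (int (m n) - int n)) \<longlonglongrightarrow> 0"
    using filterlim_compose by blast
  \<comment> \<open>The exponent is truncated at 0, so it agrees with the true difference only when
    \<open>n \<le> m n\<close>; this holds for all large \<open>n\<close>.\<close>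
  have "\<forall>\<^sub>F n in sequentially. int (m n) - int n \<ge> 0"
    using assms(4) unfolding filterlim_at_top by blast
  then show "\<forall>\<^sub>F n in sequentially.
      measure_pmf.prob (uniform_mat (m n) n :: 'a mat pmf) {A. is_minor M (column_matroid A)}
        \<le> (1 / ?q) ^ nat (int (m n) - int n)"
  proof eventually_elim
    case (elim n)
    have "measure_pmf.prob (uniform_mat (m n) n :: 'a mat pmf) {A. is_minor M (column_matroid A)}
        \<le> measure_pmf.prob (uniform_mat (m n) n :: 'a mat pmf) {A. \<not> free (column_matroid A)}"
      \<comment> \<open>Since \<open>M\<close> is not free, no free matroid has it as a
        minor.\<close>
      using assms(2) free_minor by (intro measure_pmf.finite_measure_mono) auto
    also have "\<dots> \<le> ?q ^ n / ?q ^ m n" by (rule prob_not_free_le)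
    also have "\<dots> = (1 / ?q) ^ (m n - n)"
      using elim q by (simp add: power_diff power_one_over field_simps)
    also have "m n - n = nat (int (m n) - int n)" by simp
    finally show ?case .
  qed
qed auto

end
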